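(* Let $T$ be a multivalued maximal monotone operator from $\mathbb{R}^n$ to $\mathbb{R}^n$ such that $T^{-1}0\neq\emptyset$, i.e. there exists $x\in\mathbb{R}^n$ with $0\in Tx$. Then every parallel Jacobi algorithm associated with the single-valued mapping $F=(I+T)^{-1}:\mathbb{R}^n\to\mathbb{R}^n$ converges: for every $x^0\in\mathbb{R}^n$, the sequence defined by $$x_i^{p+1}=F_i(x_1^p,\dots,x_\alpha^p),\qquad i=1,\dots,\alpha,\quad p=0,1,2,\dots$$ converges in $\mathbb{R}^n$ to some $x^*$ which is a solution of the problem $0\in Tx$.
   Context: Let $\alpha\ge1$ be an integer, $n=\sum_{i=1}^\alpha n_i$, and write $\mathbb{R}^n=\prod_{i=1}^\alpha\mathbb{R}^{n_i}$, with $x=(x_1,\dots,x_\alpha)$, $x_i\in\mathbb{R}^{n_i}$; $F_i:\mathbb{R}^n\to\mathbb{R}^{n_i}$ is the $i$-th block component of $F$. Each $\mathbb{R}^{n_i}$ carries an inner product $\langle\cdot,\cdot\rangle_i$ and $\mathbb{R}^n$ carries $\langle x,y\rangle=\sum_{i=1}^\alpha\langle x_i,y_i\rangle_i$. A multivalued operator $T$ is monotone if $\langle w-w',x-x'\rangle\ge0$ whenever $w\in Tx$, $w'\in Tx'$; it is maximal monotone if its graph is not properly contained in the graph of another monotone operator. For maximal monotone $T$, the mapping $(I+T)^{-1}$ (the proximal mapping associated with $T$) is single-valued and defined on all of $\mathbb{R}^n$: $y=(I+T)^{-1}x$ means $x\in y+Ty$. *)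

theory Defs
  imports "HOL-Analysis.Analysis"
begin

text \<open>
  The product of the spaces \<open>\<real>\<^sup>d\<^sup>i\<close> (block dimensions \<open>d i\<close>, \<open>1 \<le> i \<le> \<alpha>\<close>) is modelled
  as \<open>real ^ 'n\<close> together with a map \<open>b\<close> that sends each coordinate to the number of the
  block it belongs to; block \<open>i\<close> consists of \<open>d i\<close> coordinates, so the blocks' dimensions
  add up to \<open>CARD('n)\<close>. The \<open>i\<close>-th factor is identified with the vectors supported on
  block \<open>i\<close>.
\<close>

definition block_structure :: "nat \<Rightarrow> (nat \<Rightarrow> nat) \<Rightarrow> ('n::finite \<Rightarrow> nat) \<Rightarrow> bool" where
  "block_structure \<alpha> d b \<longleftrightarrow>
     (\<forall>j. b j \<in> {1..\<alpha>}) \<and> (\<forall>i\<in>{1..\<alpha>}. card {j. b j = i} = d i)"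

definition block_space :: "('n::finite \<Rightarrow> nat) \<Rightarrow> nat \<Rightarrow> (real ^ 'n) set" where
  "block_space b i = {x. \<forall>j. b j \<noteq> i \<longrightarrow> x $ j = 0}"

definition block :: "('n::finite \<Rightarrow> nat) \<Rightarrow> nat \<Rightarrow> real ^ 'n \<Rightarrow> real ^ 'n" where
  "block b i x = (\<chi> j. if b j = i then x $ j else 0)"

definition inner_product_on :: "'v::real_vector set \<Rightarrow> ('v \<Rightarrow> 'v \<Rightarrow> real) \<Rightarrow> bool" where
  "inner_product_on S ip \<longleftrightarrow>
     (\<forall>x\<in>S. \<forall>y\<in>S. ip x y = ip y x) \<and>
     (\<forall>x\<in>S. \<forall>y\<in>S. \<forall>z\<in>S. ip (x + y) z = ip x z + ip y z) \<and>
     (\<forall>c. \<forall>x\<in>S. \<forall>y\<in>S. ip (c *\<^sub>R x) y = c * ip x y) \<and>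
     (\<forall>x\<in>S. x \<noteq> 0 \<longrightarrow> ip x x > 0)"

definition product_inner ::
  "nat \<Rightarrow> ('n::finite \<Rightarrow> nat) \<Rightarrow> (nat \<Rightarrow> real ^ 'n \<Rightarrow> real ^ 'n \<Rightarrow> real) \<Rightarrow> real ^ 'n \<Rightarrow> real ^ 'n \<Rightarrow> real"
where
  "product_inner \<alpha> b ip x y = (\<Sum>i=1..\<alpha>. ip i (block b i x) (block b i y))"

text \<open>
  A multivalued operator is a set-valued function; monotonicity is relative to an explicitly
  given inner product \<open>ip\<close>, not to the one of the type class.
\<close>

definition op_graph :: "('v \<Rightarrow> 'v set) \<Rightarrow> ('v \<times> 'v) set" where
  "op_graph T = {(x, w). w \<in> T x}"

definition op_inverse :: "('v \<Rightarrow> 'v set) \<Rightarrow> 'v \<Rightarrow> 'v set" where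
  "op_inverse T x = {y. x \<in> T y}"

definition monotone_operator ::
  "('v::real_vector \<Rightarrow> 'v \<Rightarrow> real) \<Rightarrow> ('v \<Rightarrow> 'v set) \<Rightarrow> bool" where
  "monotone_operator ip T \<longleftrightarrow>
     (\<forall>x x' w w'. w \<in> T x \<longrightarrow> w' \<in> T x' \<longrightarrow> ip (w - w') (x - x') \<ge> 0)"

definition maximal_monotone_operator ::
  "('v::real_vector \<Rightarrow> 'v \<Rightarrow> real) \<Rightarrow> ('v \<Rightarrow> 'v set) \<Rightarrow> bool" where
  "maximal_monotone_operator ip T \<longleftrightarrow>
     monotone_operator ip T \<and>
     \<not> (\<exists>S. monotone_operator ip S \<and> op_graph T \<subset> op_graph S)"

text \<open>
  The description operator picks the unique element of \<open>(I + T)\<^sup>-\<^sup>1 x\<close>; for maximal monotone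
  \<open>T\<close> on a finite-dimensional space this element exists and is unique for every \<open>x\<close>
  (Minty's theorem).
\<close>

definition proximal_mapping :: "('v::real_vector \<Rightarrow> 'v set) \<Rightarrow> 'v \<Rightarrow> 'v" where
  "proximal_mapping T x = (THE y. y \<in> op_inverse (\<lambda>y. (\<lambda>w. y + w) ` T y) x)"

definition parallel_jacobi ::
  "nat \<Rightarrow> ('n::finite \<Rightarrow> nat) \<Rightarrow> (real ^ 'n \<Rightarrow> real ^ 'n) \<Rightarrow> real ^ 'n \<Rightarrow> (nat \<Rightarrow> real ^ 'n) \<Rightarrow> bool"
where
  "parallel_jacobi \<alpha> b F x0 x \<longleftrightarrow>
     x 0 = x0 \<and> (\<forall>p. \<forall>i\<in>{1..\<alpha>}. block b i (x (Suc p)) = block b i (F (x p)))"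

end

theory Submission
  imports Defs
begin

text \<open>
  Since every block is updated from the same old iterate, a parallel Jacobi step is one step
  \<open>x \<mapsto> (I + T)\<^sup>-\<^sup>1 x\<close> of the proximal point algorithm for the product inner product.
  Its steps decrease the distance to every zero of \<open>T\<close>, and the decrease
  controls the step length, which therefore tends to zero. Hence a cluster point \<open>z\<close> of the
  bounded iterates is monotonically related to the whole graph of \<open>T\<close> with value \<open>0\<close>, so
  \<open>0 \<in> T z\<close> by maximality, and the distances to \<open>z\<close> decrease to zero.

  That the resolvent is everywhere defined (Minty) reduces by compactness to finite monotone sets of
  pairs \<open>(a, w)\<close>. There a solution comes from minimising the convex function
  \<open>\<parallel>a - w\<parallel>\<^sup>2 / 4 + s\<close> over the convex hull of the triples \<open>(a, w, \<langle>a, w\<rangle>)\<close>.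
\<close>

text \<open>First-order condition at a minimum: dividing by \<open>t\<close> and letting
  \<open>t\<close> tend to 0 leaves \<open>D\<close>.\<close>

lemma nonneg_linear_coeffI:
  fixes D Q :: real
  assumes "\<And>t. 0 < t \<Longrightarrow> t \<le> 1 \<Longrightarrow> 0 \<le> t * D + t\<^sup>2 * Q"
  shows "0 \<le> D"
proof (rule ccontr)
  assume "\<not> 0 \<le> D"
  \<comment> \<open>Small enough that \<open>t * \<bar>Q\<bar>\<close> cancels at most half of
    \<open>D\<close>.\<close>
  define t where "t = min 1 (- D / (2 * (\<bar>Q\<bar> + 1)))"
  have t: "0 < t" "t \<le> 1" using \<open>\<not> 0 \<le> D\<close> by (auto simp: t_def divide_neg_pos)
  have "0 \<le> t * (D + t * Q)"
    using assms[OF t] by (simp add: power2_eq_square algebra_simps)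
  then have "0 \<le> D + t * Q" using t by (simp add: zero_le_mult_iff)
  also have "t * Q \<le> t * (\<bar>Q\<bar> + 1)" using t by (intro mult_left_mono) auto
  also have "\<dots> \<le> - D / (2 * (\<bar>Q\<bar> + 1)) * (\<bar>Q\<bar> + 1)"
    by (intro mult_right_mono) (auto simp: t_def)
  also have "\<dots> = - D / 2" by (simp add: field_simps)
  finally show False using \<open>\<not> 0 \<le> D\<close> by simp
qed

section \<open>Norm and topology of a given inner product\<close>

locale inner_product_form =
  fixes B :: "'a::euclidean_space \<Rightarrow> 'a \<Rightarrow> real"
  assumes inner_product_on_UNIV: "inner_product_on UNIV B"
begin

lemma form_commute: "B x y = B y x"
  and form_pos: "x \<noteq> 0 \<Longrightarrow> 0 < B x x"
  using inner_product_on_UNIV by (auto simp: inner_product_on_def)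

text \<open>Finite dimension makes the bilinear form bounded, which supplies continuity and limit
  rules for \<open>B\<close>.\<close>

sublocale bounded_bilinear B
proof -
  have add: "B (x + y) z = B x z + B y z" and scale: "B (c *\<^sub>R x) y = c * B x y" for c x y z
    using inner_product_on_UNIV by (auto simp: inner_product_on_def)
  have "bilinear B"
    unfolding bilinear_def
  proof (intro conjI allI)
    show "linear (\<lambda>y. B x y)" for x
      by (rule linearI) (simp_all only: form_commute[of x] add scale real_scaleR_def)
    show "linear (\<lambda>x. B x y)" for y
      by (rule linearI) (simp_all only: add scale real_scaleR_def)
  qed
  then show "bounded_bilinear B" by (simp add: bilinear_conv_bounded_bilinear)
qed

lemmas form_simps = add_left add_right diff_left diff_right minus_left minus_right
  scaleR_left scaleR_right

lemma form_nonneg: "0 \<le> B x x"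
  using form_pos[of x] by (cases "x = 0") (auto simp: zero_left)

text \<open>The form attains a positive minimum on the compact unit sphere; homogeneity of degree
  two carries the bound to all vectors.\<close>

lemma form_coercive: "\<exists>c>0. \<forall>x. c * (norm x)\<^sup>2 \<le> B x x"
proof -
  obtain u :: 'a where "u \<in> Basis" using nonempty_Basis by blast
  then have "u \<in> sphere 0 1" by simp
  moreover have "continuous_on (sphere (0::'a) 1) (\<lambda>x. B x x)"
    by (intro continuous_on continuous_on_id)
  ultimately obtain e where e: "e \<in> sphere 0 1" "\<And>x. x \<in> sphere 0 1 \<Longrightarrow> B e e \<le> B x x"
    using continuous_attains_inf[OF compact_sphere, of 0 1 "\<lambda>x. B x x"] by blast
  show ?thesis
  proof (intro exI[of _ "B e e"] conjI allI)
    show "0 < B e e" using e by (intro form_pos) auto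
    show "B e e * (norm x)\<^sup>2 \<le> B x x" for x
    proof (cases "x = 0")
      case False
      then have "B e e \<le> B (x /\<^sub>R norm x) (x /\<^sub>R norm x)" by (intro e) simp
      also have "\<dots> = B x x / (norm x)\<^sup>2"
        by (simp add: form_simps power2_eq_square field_simps)
      finally show ?thesis using False by (simp add: field_simps)
    qed (simp add: zero_left)
  qed
qed

lemma bounded_form_ball: "bounded {x. B (x - z) (x - z) \<le> r}"
proof -
  obtain c where c: "c > 0" "\<And>x. c * (norm x)\<^sup>2 \<le> B x x" using form_coercive by blast
  have "norm (x - z) \<le> sqrt (r / c)" if "B (x - z) (x - z) \<le> r" for x
    using c(2)[of "x - z"] that c(1) by (intro real_le_rsqrt) (simp add: field_simps)
  then show ?thesis
    unfolding bounded_def dist_norm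
    by (intro exI[of _ z] exI[of _ "sqrt (r / c)"]) (auto simp: norm_minus_commute)
qed

lemma tendsto_if_form_tendsto_0:
  assumes "((\<lambda>p. B (x p - z) (x p - z)) \<longlongrightarrow> 0) F"
  shows "(x \<longlongrightarrow> z) F"
proof -
  obtain c where c: "c > 0" "\<And>x. c * (norm x)\<^sup>2 \<le> B x x" using form_coercive by blast
  have lim: "((\<lambda>p. sqrt (B (x p - z) (x p - z) / c)) \<longlongrightarrow> 0) F"
    using tendsto_real_sqrt[OF tendsto_divide[OF assms tendsto_const, of c]] c(1) by simp
  have le: "norm (x p - z) \<le> sqrt (B (x p - z) (x p - z) / c)" for p
    using c(2)[of "x p - z"] c(1) by (intro real_le_rsqrt) (simp add: field_simps)
  have "((\<lambda>p. x p - z) \<longlongrightarrow> 0) F"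
    by (rule Lim_null_comparison[OF always_eventually lim]) (use le in simp)
  then show ?thesis by (simp add: LIM_zero_iff)
qed

section \<open>Minty's theorem\<close>

text \<open>A relaxed resolvent equation at 0: the pair \<open>(y, - y)\<close> is to be
  monotonically related to \<open>G\<close>.\<close>

lemma monotone_related_finite:
  assumes "finite G"
    and mono: "\<And>a w a' w'. (a, w) \<in> G \<Longrightarrow> (a', w') \<in> G \<Longrightarrow> 0 \<le> B (w - w') (a - a')"
  shows "\<exists>y. \<forall>(a, w)\<in>G. 0 \<le> B (w + y) (a - y)"
proof (cases "G = {}")
  case False
  define \<phi> where "\<phi> = (\<lambda>(a, w). (a, w, B a w))"
  define K where "K = convex hull (\<phi> ` G)"
  define h where "h = (\<lambda>(a, w, s). B (a - w) (a - w) / 4 + s)"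
  \<comment> \<open>Affine in each triple separately, so monotonicity on \<open>G\<close> extends to the convex hull
    one argument at a time.\<close>
  define m where "m = (\<lambda>(a, w, s) (a', w', s'). s + s' - B a w' - B a' w)"
  have convex_m: "convex {q. 0 \<le> m p q}" for p
  proof (rule convexI, clarsimp)
    fix a w s a' w' s' and u v :: real
    assume "0 \<le> m p (a, w, s)" "0 \<le> m p (a', w', s')" and uv: "0 \<le> u" "0 \<le> v" "u + v = 1"
    moreover obtain a0 w0 s0 where p: "p = (a0, w0, s0)" by (cases p)
    ultimately have "0 \<le> u * m p (a, w, s) + v * m p (a', w', s')" by simp
    also have "\<dots> = (u + v) * s0 + u * s + v * s' - (u * B a0 w + v * B a0 w')
        - (u * B a w0 + v * B a' w0)"
      by (simp add: p m_def algebra_simps)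
    finally show "0 \<le> m p (u *\<^sub>R a + v *\<^sub>R a', u *\<^sub>R w + v *\<^sub>R w', u * s + v * s')"
      using uv by (simp add: p m_def form_simps)
  qed
  have m_commute: "m p q = m q p" for p q
    by (cases p; cases q) (simp add: m_def)
  have m_gen: "0 \<le> m p q" if "p \<in> \<phi> ` G" "q \<in> \<phi> ` G" for p q
    using that mono by (fastforce simp: \<phi>_def m_def form_simps form_commute)
  have "K \<subseteq> {q. 0 \<le> m p q}" if "p \<in> \<phi> ` G" for p
    unfolding K_def using m_gen[OF that] by (intro hull_minimal convex_m) auto
  then have "K \<subseteq> {q. 0 \<le> m p q}" if "p \<in> K" for p
    unfolding K_def using that by (intro hull_minimal convex_m) (auto simp: K_def m_commute[of p])
  \<comment> \<open>On the diagonal \<open>m\<close> is twice \<open>s - B a w\<close>, so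
    \<open>s\<close> dominates \<open>B a w\<close> throughout \<open>K\<close>.\<close>
  then have m_diag: "0 \<le> m p p" if "p \<in> K" for p using that by blast
  have "continuous_on K h"
    unfolding h_def split_def by (intro continuous_intros continuous_on) auto
  moreover have "compact K" unfolding K_def using assms(1)
    by (intro compact_convex_hull finite_imp_compact) auto
  moreover have "K \<noteq> {}" using False by (simp add: K_def)
  ultimately obtain k where k: "k \<in> K" "\<And>q. q \<in> K \<Longrightarrow> h k \<le> h q"
    using continuous_attains_inf[of K h] by blast
  obtain a0 w0 s0 where k_eq: "k = (a0, w0, s0)" by (cases k)
  \<comment> \<open>The gradient with respect to \<open>B\<close>, in the variable
    \<open>a - w\<close>, of the quadratic part of \<open>h\<close> at the minimiser
    \<open>k\<close>.\<close>
  define y where "y = (1/2) *\<^sub>R (a0 - w0)"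
  have ge: "0 \<le> s0 + B y y"
  proof -
    have "0 \<le> s0 - B a0 w0" using m_diag[OF k(1)] by (simp add: k_eq m_def)
    moreover have "B a0 w0 + B y y = B (a0 + w0) (a0 + w0) / 4"
      by (simp add: y_def form_simps form_commute[of w0 a0] field_simps)
    ultimately show ?thesis using form_nonneg[of "a0 + w0"] by linarith
  qed
  show ?thesis
  proof (intro exI[of _ y] ballI, clarify)
    fix a w assume aw: "(a, w) \<in> G"
    define g where "g = \<phi> (a, w)"
    have "g \<in> K" using aw by (auto simp: g_def K_def intro: hull_inc)
    \<comment> \<open>The one-sided derivative of \<open>h\<close> at \<open>k\<close> towards
      \<open>g\<close>, nonnegative because \<open>k\<close> is minimal on the convex set
      \<open>K\<close>.\<close>
    define D where "D = B y (a - w) - B y (a0 - w0) + B a w - s0"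
    define e where "e = (a - w) - (a0 - w0)"
    have "0 \<le> D"
    proof (rule nonneg_linear_coeffI[where Q = "B e e / 4"])
      fix t :: real assume t: "0 < t" "t \<le> 1"
      have "(1 - t) *\<^sub>R k + t *\<^sub>R g \<in> K"
        using convexD_alt[of K k g t] \<open>g \<in> K\<close> k t by (simp add: K_def)
      then have "h k \<le> h ((1 - t) *\<^sub>R k + t *\<^sub>R g)" by (rule k)
      also have "h ((1 - t) *\<^sub>R k + t *\<^sub>R g)
        = B ((a0 - w0) + t *\<^sub>R e) ((a0 - w0) + t *\<^sub>R e) / 4 + ((1 - t) * s0 + t * B a w)"
        by (simp add: h_def k_eq g_def \<phi>_def e_def algebra_simps)
      also have "\<dots> = h k + t * D + t\<^sup>2 * (B e e / 4)"
      proof -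
        define u where "u = a0 - w0"
        have sq: "B (u + t *\<^sub>R e) (u + t *\<^sub>R e) = B u u + 2 * t * B u e + t\<^sup>2 * B e e"
          by (simp add: form_simps form_commute[of e u] power2_eq_square algebra_simps)
        have hk: "h k = B u u / 4 + s0" by (simp add: h_def k_eq u_def)
        have D_eq: "D = B u e / 2 + B a w - s0"
          by (simp add: D_def e_def u_def y_def form_simps diff_divide_distrib)
        show ?thesis unfolding u_def[symmetric] sq hk D_eq by (simp add: field_simps)
      qed
      finally show "0 \<le> t * D + t\<^sup>2 * (B e e / 4)" by simp
    qed
    moreover have "a0 - w0 = 2 *\<^sub>R y" by (simp add: y_def)
    then have "B y (a0 - w0) = 2 * B y y" by (simp only: scaleR_right real_scaleR_def)
    \<comment> \<open>The target equals \<open>D + (s0 + B y y)\<close>, a sum of two nonnegative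
      terms.\<close>
    ultimately show "0 \<le> B (w + y) (a - y)"
      using ge by (simp add: D_def form_simps form_commute[of w a] form_commute[of w y])
  qed
qed auto

text \<open>Each pair admits a compact set of \<open>y\<close>, and finitely many of these sets
  always meet, so all of them meet.\<close>

lemma monotone_related_exists:
  assumes mono: "\<And>a w a' w'. (a, w) \<in> G \<Longrightarrow> (a', w') \<in> G \<Longrightarrow> 0 \<le> B (w - w') (a - a')"
  shows "\<exists>y. \<forall>(a, w)\<in>G. 0 \<le> B (w + y) (a - y)"
proof (cases "G = {}")
  case False
  define C where "C = (\<lambda>(a, w). {y. 0 \<le> B (w + y) (a - y)})"
  have closed_C: "closed (C p)" for p
    unfolding C_def split_def by (intro closed_Collect_le continuous_intros continuous_on)
  have bounded_C: "bounded (C p)" for p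
  proof (cases p)
    case (Pair a w)
    \<comment> \<open>Completing the square shows that \<open>C p\<close> is a closed ball for
      \<open>B\<close> with centre \<open>c\<close>.\<close>
    define c where "c = (1/2) *\<^sub>R (a - w)"
    have "B (w + y) (a - y) = B (a + w) (a + w) / 4 - B (y - c) (y - c)" for y
      by (simp add: c_def form_simps form_commute[of w a] form_commute[of w y] form_commute[of y a] field_simps)
    then have "C p \<subseteq> {y. B (y - c) (y - c) \<le> B (a + w) (a + w) / 4}"
      by (auto simp: C_def Pair)
    then show ?thesis using bounded_form_ball bounded_subset by blast
  qed
  obtain p where "p \<in> G" using False by blast
  have "C p \<inter> \<Inter> (C ` G) \<noteq> {}"
  proof (rule compact_imp_fip)
    show "compact (C p)" using closed_C bounded_C by (simp add: compact_eq_bounded_closed)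
    show "closed S" if "S \<in> C ` G" for S using that closed_C by blast
    fix \<F> assume "finite \<F>" "\<F> \<subseteq> C ` G"
    then obtain H where H: "finite H" "H \<subseteq> G" "\<F> = C ` H" by (meson finite_subset_image)
    have "\<exists>y. \<forall>(a, w)\<in>insert p H. 0 \<le> B (w + y) (a - y)"
      using H \<open>p \<in> G\<close> by (intro monotone_related_finite) (auto intro!: mono)
    then obtain y where "\<forall>(a, w)\<in>insert p H. 0 \<le> B (w + y) (a - y)" ..
    then have "y \<in> C p \<inter> \<Inter> \<F>" by (auto simp: C_def H split: prod.splits)
    then show "C p \<inter> \<Inter> \<F> \<noteq> {}" by blast
  qed
  then show ?thesis by (fastforce simp: C_def)
qed auto

lemma monotone_operatorD:
  assumes "monotone_operator B T" "w \<in> T x" "w' \<in> T x'"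
  shows "0 \<le> B (w - w') (x - x')"
  using assms by (auto simp: monotone_operator_def)

text \<open>Adjoining the pair \<open>(y, v)\<close> to the graph keeps it monotone, so by
  maximality the pair was already there.\<close>

lemma maximal_monotone_memI:
  assumes T: "maximal_monotone_operator B T"
    and rel: "\<And>a w. w \<in> T a \<Longrightarrow> 0 \<le> B (w - v) (a - y)"
  shows "v \<in> T y"
proof (rule ccontr)
  assume "v \<notin> T y"
  define S where "S = T(y := insert v (T y))"
  have rel': "0 \<le> B (v - w) (y - a)" if "w \<in> T a" for a w
    using rel[OF that] by (simp add: form_simps)
  have S_iff: "w \<in> S x \<longleftrightarrow> w \<in> T x \<or> (x = y \<and> w = v)" for w x
    by (auto simp: S_def)
  have "monotone_operator B S"
    unfolding monotone_operator_def S_iff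
    using rel rel' T[unfolded maximal_monotone_operator_def monotone_operator_def]
    by (auto simp: zero_left)
  moreover have "op_graph T \<subset> op_graph S"
    using \<open>v \<notin> T y\<close> by (auto simp: op_graph_def S_iff)
  ultimately show False using T by (auto simp: maximal_monotone_operator_def)
qed

theorem minty:
  assumes T: "maximal_monotone_operator B T"
  shows "\<exists>!y. x - y \<in> T y"
proof (rule ex_ex1I)
  have mono: "monotone_operator B T" using T by (simp add: maximal_monotone_operator_def)
  \<comment> \<open>Translating the values of \<open>T\<close> by \<open>x\<close> moves the
    resolvent equation from \<open>x\<close> to 0: \<open>w - x + y\<close> is
    \<open>w - (x - y)\<close>.\<close>
  have "\<exists>y. \<forall>(a, w) \<in> {(a, w - x) |a w. w \<in> T a}. 0 \<le> B (w + y) (a - y)"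
    by (rule monotone_related_exists) (auto dest: monotone_operatorD[OF mono])
  then obtain y where y: "\<And>a w. w \<in> T a \<Longrightarrow> 0 \<le> B (w - x + y) (a - y)" by blast
  have "x - y \<in> T y"
    by (rule maximal_monotone_memI[OF T]) (use y in \<open>simp add: algebra_simps\<close>)
  then show "\<exists>y. x - y \<in> T y" ..
  fix y y' assume "x - y \<in> T y" "x - y' \<in> T y'"
  from monotone_operatorD[OF mono this] have "B (y - y') (y - y') \<le> 0"
    by (simp add: form_simps)
  then show "y = y'" using form_pos[of "y - y'"] by force
qed

text \<open>Minty's theorem supplies the existence and uniqueness on which the description operator
  depends.\<close>

lemma proximal_mapping_residual:
  assumes "maximal_monotone_operator B T"
  shows "x - proximal_mapping T x \<in> T (proximal_mapping T x)"
proof -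
  have "y \<in> op_inverse (\<lambda>y. (\<lambda>w. y + w) ` T y) x \<longleftrightarrow> x - y \<in> T y" for y
    by (auto simp: op_inverse_def intro: image_eqI[of _ _ "x - y"])
  then have "proximal_mapping T x = (THE y. x - y \<in> T y)"
    by (simp add: proximal_mapping_def)
  then show ?thesis using theI'[OF minty[OF assms]] by simp
qed

section \<open>Convergence of the proximal point algorithm\<close>

theorem proximal_point_convergence:
  assumes T: "maximal_monotone_operator B T"
    and zero: "0 \<in> T z"
    and step: "\<And>p. x p - x (Suc p) \<in> T (x (Suc p))"
  shows "\<exists>xs. x \<longlonglongrightarrow> xs \<and> 0 \<in> T xs"
proof -
  have mono: "monotone_operator B T" using T by (simp add: maximal_monotone_operator_def)
  define dsq where "dsq = (\<lambda>u p. B (x p - u) (x p - u))"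
  define \<delta> where "\<delta> = (\<lambda>p. x p - x (Suc p))"
  \<comment> \<open>Expanding the square leaves a cross term that is nonnegative by monotonicity,
    applied to the pairs \<open>(x (Suc p), \<delta> p)\<close> and \<open>(u, 0)\<close>.\<close>
  have fejer: "B (\<delta> p) (\<delta> p) \<le> dsq u p - dsq u (Suc p)" if "0 \<in> T u" for u p
  proof -
    have "dsq u p = B (\<delta> p + (x (Suc p) - u)) (\<delta> p + (x (Suc p) - u))"
      by (simp add: dsq_def \<delta>_def)
    also have "\<dots> = B (\<delta> p) (\<delta> p) + 2 * B (\<delta> p) (x (Suc p) - u) + dsq u (Suc p)"
      by (simp only: add_left add_right dsq_def form_commute[of "x (Suc p) - u" "\<delta> p"])
    finally show ?thesis
      using monotone_operatorD[OF mono step that, of p] by (simp add: \<delta>_def)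
  qed
  have decseq: "decseq (dsq u)" if "0 \<in> T u" for u
  proof (rule decseq_SucI)
    show "dsq u (Suc p) \<le> dsq u p" for p
      using fejer[OF that, of p] form_nonneg[of "\<delta> p"] by linarith
  qed
  have dsq_convergent: "\<exists>L. dsq u \<longlonglongrightarrow> L" if "0 \<in> T u" for u
    by (rule decseq_convergent[OF decseq[OF that], of 0]) (auto simp: dsq_def form_nonneg)
  have "range x \<subseteq> {v. B (v - z) (v - z) \<le> dsq z 0}"
    using decseqD[OF decseq[OF zero], of 0] by (auto simp: dsq_def)
  then have "bounded (range x)" using bounded_form_ball bounded_subset by blast
  \<comment> \<open>Squared step lengths are squeezed between 0 and consecutive differences of a
    convergent sequence.\<close>
  have "(\<lambda>p. B (\<delta> p) (\<delta> p)) \<longlonglongrightarrow> 0"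
  proof -
    obtain L where L: "dsq z \<longlonglongrightarrow> L" using dsq_convergent[OF zero] ..
    have "(\<lambda>p. dsq z p - dsq z (Suc p)) \<longlonglongrightarrow> L - L"
      by (intro tendsto_diff L LIMSEQ_Suc)
    then have "(\<lambda>p. dsq z p - dsq z (Suc p)) \<longlonglongrightarrow> 0" by simp
    then show ?thesis
      by (rule tendsto_sandwich[OF _ _ tendsto_const, rotated 2]) (auto simp: form_nonneg fejer zero)
  qed
  then have \<delta>: "\<delta> \<longlonglongrightarrow> 0"
    using tendsto_if_form_tendsto_0[of \<delta> 0] by simp
  obtain xs r where r: "strict_mono (r :: nat \<Rightarrow> nat)" and xr: "(x \<circ> r) \<longlonglongrightarrow> xs"
    using bounded_imp_convergent_subsequence[OF \<open>bounded (range x)\<close>] by blast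
  have \<delta>r: "(\<lambda>p. \<delta> (r p)) \<longlonglongrightarrow> 0"
    using LIMSEQ_subseq_LIMSEQ[OF \<delta> r] by (simp add: o_def)
  \<comment> \<open>\<open>\<delta> (r p)\<close> is a value of \<open>T\<close> at the new iterate,
    so monotonicity passes to the limit along the shifted subsequence.\<close>
  have xSr: "(\<lambda>p. x (Suc (r p))) \<longlonglongrightarrow> xs"
    using tendsto_diff[OF xr \<delta>r] by (simp add: o_def \<delta>_def)
  have xs: "0 \<in> T xs"
  proof (rule maximal_monotone_memI[OF T])
    fix a w assume w: "w \<in> T a"
    have "(\<lambda>p. B (w - \<delta> (r p)) (a - x (Suc (r p)))) \<longlonglongrightarrow> B (w - 0) (a - xs)"
      by (intro tendsto tendsto_diff tendsto_const \<delta>r xSr)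
    then show "0 \<le> B (w - 0) (a - xs)"
      by (rule LIMSEQ_le_const) (use monotone_operatorD[OF mono w step] in \<open>auto simp: \<delta>_def\<close>)
  qed
  \<comment> \<open>Since \<open>xs\<close> is a zero, the distances to it converge along the whole
    sequence; the subsequence identifies their limit as 0.\<close>
  obtain L where L: "dsq xs \<longlonglongrightarrow> L" using dsq_convergent[OF xs] ..
  have "(\<lambda>p. dsq xs (r p)) \<longlonglongrightarrow> B (xs - xs) (xs - xs)"
    unfolding dsq_def using xr by (intro tendsto tendsto_diff tendsto_const) (auto simp: o_def)
  moreover have "(\<lambda>p. dsq xs (r p)) \<longlonglongrightarrow> L"
    using LIMSEQ_subseq_LIMSEQ[OF L r] by (simp add: o_def)
  ultimately have "L = B (xs - xs) (xs - xs)" by (rule LIMSEQ_unique[rotated])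
  then have "L = 0" by (simp add: zero_left)
  then have "x \<longlonglongrightarrow> xs"
    using L by (intro tendsto_if_form_tendsto_0) (simp add: dsq_def)
  then show ?thesis using xs by blast
qed

end

section \<open>Product inner product and the Jacobi iteration\<close>

lemma block_add: "block b i (x + y) = block b i x + block b i y"
  and block_scaleR: "block b i (c *\<^sub>R x) = c *\<^sub>R block b i x"
  and block_in_block_space: "block b i x \<in> block_space b i"
  by (auto simp: block_def block_space_def vec_eq_iff)

lemma inner_product_on_product_inner:
  assumes b: "\<And>j. b j \<in> {1..\<alpha>}"
    and ip: "\<And>i. i \<in> {1..\<alpha>} \<Longrightarrow> inner_product_on (block_space b i) (ip i)"
  shows "inner_product_on UNIV (product_inner \<alpha> b ip)"
proof -
  note ip' = ip[unfolded inner_product_on_def]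
  have nonneg: "0 \<le> ip i (block b i x) (block b i x)" if "i \<in> {1..\<alpha>}" for i x
  proof (cases "block b i x = 0")
    case True
    \<comment> \<open>Positivity is only given for nonzero vectors; at 0 the value comes from
      homogeneity with factor 0.\<close>
    have "ip i (0 *\<^sub>R block b i x) (block b i x) = 0 * ip i (block b i x) (block b i x)"
      using ip'[OF that] block_in_block_space by blast
    then show ?thesis using True by simp
  next
    case False
    then show ?thesis using ip'[OF that] block_in_block_space less_imp_le by blast
  qed
  have "0 < product_inner \<alpha> b ip x x" if nz: "x \<noteq> 0" for x
  proof -
    \<comment> \<open>A nonzero coordinate \<open>j\<close> makes the summand of block
      \<open>b j\<close> positive, while the others are nonnegative.\<close>
    obtain j where "x $ j \<noteq> 0" using nz by (auto simp: vec_eq_iff)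
    then have "block b (b j) x \<noteq> 0" by (auto simp: block_def vec_eq_iff)
    then have "0 < ip (b j) (block b (b j) x) (block b (b j) x)"
      using ip'[OF b] block_in_block_space by blast
    then show ?thesis
      unfolding product_inner_def using b nonneg by (intro sum_pos2[of _ "b j"]) auto
  qed
  moreover have "product_inner \<alpha> b ip x y = product_inner \<alpha> b ip y x" for x y
    unfolding product_inner_def
    by (intro sum.cong refl) (use ip' block_in_block_space in blast)
  moreover have "product_inner \<alpha> b ip (x + y) z = product_inner \<alpha> b ip x z + product_inner \<alpha> b ip y z"
    for x y z
    unfolding product_inner_def block_add sum.distrib[symmetric]
    by (intro sum.cong refl) (use ip' block_in_block_space in blast)
  moreover have "product_inner \<alpha> b ip (c *\<^sub>R x) y = c * product_inner \<alpha> b ip x y" for c x y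
    unfolding product_inner_def block_scaleR sum_distrib_left
    by (intro sum.cong refl) (use ip' block_in_block_space in blast)
  ultimately show ?thesis by (auto simp: inner_product_on_def)
qed

text \<open>Every coordinate lies in one of the blocks 1 to \<open>\<alpha>\<close>, so the block
  equations determine the whole vector.\<close>

lemma parallel_jacobi_Suc:
  assumes "\<And>j. b j \<in> {1..\<alpha>}" "parallel_jacobi \<alpha> b F x0 x"
  shows "x (Suc p) = F (x p)"
proof -
  have "x (Suc p) $ j = F (x p) $ j" for j
  proof -
    have "block b (b j) (x (Suc p)) = block b (b j) (F (x p))"
      using assms by (auto simp: parallel_jacobi_def)
    then have "block b (b j) (x (Suc p)) $ j = block b (b j) (F (x p)) $ j" by simp
    then show ?thesis by (simp add: block_def)
  qed
  then show ?thesis by (simp add: vec_eq_iff)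
qed

theorem theorem4:
  fixes \<alpha> :: nat
    and d :: "nat \<Rightarrow> nat"
    and b :: "'n::finite \<Rightarrow> nat"
    and ip :: "nat \<Rightarrow> real ^ 'n \<Rightarrow> real ^ 'n \<Rightarrow> real"
    and T :: "real ^ 'n \<Rightarrow> (real ^ 'n) set"
  assumes "\<alpha> \<ge> 1"
    and "block_structure \<alpha> d b"
    and "\<And>i. i \<in> {1..\<alpha>} \<Longrightarrow> inner_product_on (block_space b i) (ip i)"
    and "maximal_monotone_operator (product_inner \<alpha> b ip) T"
    and "op_inverse T 0 \<noteq> {}"
  shows "\<forall>x0 x. parallel_jacobi \<alpha> b (proximal_mapping T) x0 x \<longrightarrow>
           (\<exists>xs. x \<longlonglongrightarrow> xs \<and> 0 \<in> T xs)"
proof (intro allI impI)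
  fix x0 x assume jacobi: "parallel_jacobi \<alpha> b (proximal_mapping T) x0 x"
  have b: "b j \<in> {1..\<alpha>}" for j using assms(2) by (simp add: block_structure_def)
  interpret inner_product_form "product_inner \<alpha> b ip"
    by unfold_locales (rule inner_product_on_product_inner[OF b assms(3)])
  obtain z where "0 \<in> T z" using assms(5) by (auto simp: op_inverse_def)
  with assms(4) show "\<exists>xs. x \<longlonglongrightarrow> xs \<and> 0 \<in> T xs"
  proof (rule proximal_point_convergence)
    show "x p - x (Suc p) \<in> T (x (Suc p))" for p
      unfolding parallel_jacobi_Suc[OF b jacobi] by (rule proximal_mapping_residual[OF assms(4)])
  qed
qed

end
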